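(* Let $O\subseteq\mathbb{R}^m$ be nonempty, open and convex, let $f,g:O\to\mathbb{R}$ be continuous convex functions, and let $X\subseteq O$ be a nonempty compact convex set that is not a singleton. Assume that the problem $\min\{f(x): g(x)\le 0,\ x\in X\}$ has a nonempty set of optimal solutions, and that lower-$\mathcal{C}^2$ representations $f=\max_{t\in T_f}f_t$ and $g=\max_{t\in T_g}g_t$ are given on an open set $O'$ with $X\subseteq O'\subseteq O$. Let $K_f\ge 0$ be such that $\nabla f_t$ is $K_f$-Lipschitz on $O'$ for every $t\in T_f$. Let $Y=(y_0,y_1,\ldots,y_m)$ be a poised tuple of sample points centred at $y_0\in X$ with respect to $f$, put $\Delta=\max_{1\le i\le m}|y_i-y_0|$, and suppose that $B(y_0;\Delta)\subseteq X$. Let $y\in B(y_0;\Delta)$, let $r\in\mathbb{N}$, let $t_1,\ldots,t_r\in A(y):=\operatorname{argmax}_{t\in T_f}f_t(y)$, and let $\lambda\in\mathbb{R}^r$ satisfy $\lambda_i\in[0,1]$ for all $i$ and $\sum_{i=1}^r\lambda_i=1$. Define $V:=\sum_{i=1}^r\lambda_i\nabla F_{t_i}(y)$, where $F_t$ denotes the linear interpolation model of $f_t$ over $Y$. Then there exists $v\in\partial f(y)$ such that $$|V-v|\le K_f\left(1+\tfrac{\sqrt{m}}{2}\,|\hat L^{-1}|\right)\Delta .$$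
   Context: $|\cdot|$ is the Euclidean norm on $\mathbb{R}^m$ and the spectral norm on matrices; $B(x_0;\Delta)$ is the closed ball with centre $x_0$ and radius $\Delta$. For convex $f:O\to\mathbb{R}$, $\partial f(x)=\{v\in\mathbb{R}^m: f(y)\ge f(x)+\langle v,y-x\rangle\ \text{for all } y\in O\}$. Lower-$\mathcal{C}^2$ representation of $f$ on $O'$: $f=\max_{t\in T_f}f_t$ on $O'$, where $T_f$ is a compact topological space, each $f_t$ is of class $\mathcal{C}^2$ on $O'$, and the maps $(t,x)\mapsto f_t(x)$, $(t,x)\mapsto\nabla f_t(x)$, $(t,x)\mapsto\nabla^2 f_t(x)$ are continuous on $T_f\times O'$ (similarly for $g$). Poised tuple: $Y=(y_0,\ldots,y_m)$ with $y_i\in\mathbb{R}^m$ is poised centred at $y_0$ if the $(m+1)\times(m+1)$ matrix whose $i$-th row ($i=0,\ldots,m$) is $(1,y_i^{\top})$ is invertible; it is poised with respect to $f$ if moreover all $y_i$ lie in the domain $O$ of $f$. The linear interpolation model over $Y$ of a real-valued function $h$ defined at the points $y_i$ is the unique affine function $H:\mathbb{R}^m\to\mathbb{R}$ with $H(y_i)=h(y_i)$ for $i=0,\ldots,m$; its gradient is constant. $L=L(Y)$ is the $m\times m$ matrix whose $i$-th row is $(y_i-y_0)^{\top}$, $i=1,\ldots,m$, and $\hat L=\hat L(Y)=\frac1\Delta L$. *)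

theory Defs
  imports "HOL-Analysis.Analysis"
begin

definition subdifferential :: "'a::real_inner set \<Rightarrow> ('a \<Rightarrow> real) \<Rightarrow> 'a \<Rightarrow> 'a set" where
  "subdifferential S f x = {v. \<forall>y\<in>S. f y \<ge> f x + v \<bullet> (y - x)}"

definition optimal_set :: "'a set \<Rightarrow> ('a \<Rightarrow> real) \<Rightarrow> ('a \<Rightarrow> real) \<Rightarrow> 'a set" where
  "optimal_set X f g = {x \<in> X. g x \<le> 0 \<and> (\<forall>z\<in>X. g z \<le> 0 \<longrightarrow> f x \<le> f z)}"

definition gradient :: "('a::real_inner \<Rightarrow> real) \<Rightarrow> 'a \<Rightarrow> 'a" where
  "gradient f x = (THE D. GDERIV f x :> D)"

definition hessian :: "(real^'m \<Rightarrow> real) \<Rightarrow> real^'m \<Rightarrow> real^'m^'m" where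
  "hessian f x = jacobian (gradient f) (at x)"

text \<open>Differentiability is required at every point of \<open>S\<close> in the unrestricted sense, so
  \<open>S\<close> is meant to be open.\<close>

definition C2_on :: "(real^'m \<Rightarrow> real) \<Rightarrow> (real^'m) set \<Rightarrow> bool" where
  "C2_on f S \<longleftrightarrow>
     (\<forall>x\<in>S. f differentiable (at x) \<and> gradient f differentiable (at x)) \<and>
     continuous_on S (hessian f)"

definition active_set :: "'t topology \<Rightarrow> ('t \<Rightarrow> 'a \<Rightarrow> real) \<Rightarrow> 'a \<Rightarrow> 't set" where
  "active_set T F x = {t \<in> topspace T. \<forall>s \<in> topspace T. F s x \<le> F t x}"

text \<open>The index space is an abstract topology whose points are \<open>topspace T\<close>. The equation
  \<open>f = max F\<^sub>t\<close> includes that the maximum is attained.\<close>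

definition lower_C2_rep ::
    "'t topology \<Rightarrow> ('t \<Rightarrow> real^'m \<Rightarrow> real) \<Rightarrow> (real^'m \<Rightarrow> real) \<Rightarrow> (real^'m) set \<Rightarrow> bool" where
  "lower_C2_rep T F f S \<longleftrightarrow>
     compact_space T \<and>
     (\<forall>x\<in>S. \<exists>t \<in> active_set T F x. f x = F t x) \<and>
     (\<forall>t \<in> topspace T. C2_on (F t) S) \<and>
     continuous_map (prod_topology T (top_of_set S)) euclidean (\<lambda>(t, x). F t x) \<and>
     continuous_map (prod_topology T (top_of_set S)) euclidean (\<lambda>(t, x). gradient (F t) x) \<and>
     continuous_map (prod_topology T (top_of_set S)) euclidean (\<lambda>(t, x). hessian (F t) x)"

text \<open>The \<open>m + 1\<close> sample points are indexed by \<open>'m option\<close>: \<open>Y None\<close> is the centre \<open>y\<^sub>0\<close>, and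
  \<open>Y (Some i)\<close>, with \<open>i\<close> ranging over the \<open>m\<close> elements of \<open>'m\<close>, are the points
  \<open>y\<^sub>1, \<dots>, y\<^sub>m\<close>. Likewise the column \<open>None\<close> of the matrix below is the constant column.\<close>

definition sample_matrix :: "('m::finite option \<Rightarrow> real^'m) \<Rightarrow> real^('m option)^('m option)" where
  "sample_matrix Y = (\<chi> i j. case j of None \<Rightarrow> 1 | Some k \<Rightarrow> Y i $ k)"

definition poised :: "('m::finite option \<Rightarrow> real^'m) \<Rightarrow> bool" where
  "poised Y \<longleftrightarrow> invertible (sample_matrix Y)"

definition poised_wrt :: "(real^'m) set \<Rightarrow> ('m::finite option \<Rightarrow> real^'m) \<Rightarrow> bool" where
  "poised_wrt S Y \<longleftrightarrow> poised Y \<and> (\<forall>i. Y i \<in> S)"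

definition affine_function :: "('a::real_vector \<Rightarrow> real) \<Rightarrow> bool" where
  "affine_function H \<longleftrightarrow> (\<exists>l c. linear l \<and> H = (\<lambda>x. l x + c))"

definition interp_model ::
    "('m::finite option \<Rightarrow> real^'m) \<Rightarrow> (real^'m \<Rightarrow> real) \<Rightarrow> real^'m \<Rightarrow> real" where
  "interp_model Y h = (THE H. affine_function H \<and> (\<forall>i. H (Y i) = h (Y i)))"

definition sample_radius :: "('m::finite option \<Rightarrow> real^'m) \<Rightarrow> real" where
  "sample_radius Y = Max (range (\<lambda>i. norm (Y (Some i) - Y None)))"

definition L_matrix :: "('m::finite option \<Rightarrow> real^'m) \<Rightarrow> real^'m^'m" where
  "L_matrix Y = (\<chi> i. Y (Some i) - Y None)"

definition Lhat_matrix :: "('m::finite option \<Rightarrow> real^'m) \<Rightarrow> real^'m^'m" where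
  "Lhat_matrix Y = (1 / sample_radius Y) *\<^sub>R L_matrix Y"

definition spectral_norm :: "real^'n^'m \<Rightarrow> real" where
  "spectral_norm A = onorm ((*v) A)"

end

theory Submission
  imports Defs
begin

text \<open>The vector \<open>v\<close> is the same convex combination of the true gradients \<open>\<nabla>f\<^sub>t\<^sub>i(y)\<close>. It is a
  subgradient because each active \<open>f\<^sub>t\<close> minorises \<open>f\<close> near \<open>y\<close> and touches it at \<open>y\<close>, so
  that convexity of \<open>f\<close> globalises the tangent inequality. The distance to \<open>V\<close> is estimated
  termwise: \<open>L (\<nabla>F\<^sub>t - \<nabla>f\<^sub>t(y\<^sub>0))\<close> is the vector of first-order Taylor remainders at the sample
  points, each at most \<open>K\<^sub>f \<Delta>\<^sup>2 / 2\<close>, and moving from \<open>y\<^sub>0\<close> to \<open>y\<close> costs another \<open>K\<^sub>f \<Delta>\<close>.\<close>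

section \<open>Gradients and derivatives along lines\<close>

lemma gradient_eqI:
  assumes "GDERIV f x :> D"
  shows "gradient f x = D"
  unfolding gradient_def
proof (rule the_equality)
  show "GDERIV f x :> D" by (rule assms)
next
  fix E assume "GDERIV f x :> E"
  then have "(\<lambda>h. h \<bullet> E) = (\<lambda>h. h \<bullet> D)"
    using assms unfolding gderiv_def by (rule has_derivative_unique)
  then have "(E - D) \<bullet> E = (E - D) \<bullet> D" by metis
  then have "(E - D) \<bullet> (E - D) = 0" by (simp add: inner_diff_right)
  then show "E = D" by simp
qed

text \<open>Riesz representation: a linear functional \<open>f'\<close> is the inner product with
  \<open>adjoint f' 1\<close>, so the description operator in \<open>gradient\<close> has a
  witness.\<close>

lemma differentiable_imp_GDERIV_gradient:
  fixes f :: "'a::euclidean_space \<Rightarrow> real"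
  assumes "f differentiable (at x)"
  shows "GDERIV f x :> gradient f x"
proof -
  obtain f' where f': "(f has_derivative f') (at x)"
    using assms unfolding differentiable_def by blast
  then have "f' = (\<lambda>h. h \<bullet> adjoint f' 1)"
    using adjoint_works[OF has_derivative_linear[OF f'], of _ 1] by simp
  with f' have "GDERIV f x :> adjoint f' 1" by (simp add: gderiv_def)
  with gradient_eqI[OF this] show ?thesis by simp
qed

lemma GDERIV_along_line:
  assumes "GDERIV f (x + s *\<^sub>R h) :> D"
  shows "((\<lambda>s. f (x + s *\<^sub>R h)) has_real_derivative h \<bullet> D) (at s)"
proof -
  have "((\<lambda>s. x + s *\<^sub>R h) has_derivative (\<lambda>u. u *\<^sub>R h)) (at s)"
    by (auto intro!: derivative_eq_intros)
  from has_derivative_compose[OF this assms[unfolded gderiv_def]]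
  show ?thesis by (simp add: has_field_derivative_def mult_commute_abs)
qed

section \<open>First-order Taylor remainders\<close>

lemma taylor_bound_of_lipschitz_deriv_le:
  fixes p p' :: "real \<Rightarrow> real"
  assumes d: "\<And>s. s \<in> {0..1} \<Longrightarrow> (p has_real_derivative p' s) (at s)"
    and b: "\<And>s. s \<in> {0..1} \<Longrightarrow> p' s - p' 0 \<le> C * s"
  shows "p 1 - p 0 - p' 0 \<le> C / 2"
proof -
  \<comment> \<open>The quadratic majorant minus \<open>p\<close>, up to a constant. Its derivative
    is the slack in the bound on \<open>p'\<close>, so it is nondecreasing, and comparing its
    endpoint values gives the claim.\<close>
  let ?q = "\<lambda>s. C / 2 * s\<^sup>2 + p' 0 * s - p s"
  have "?q 0 \<le> ?q 1"
  proof (rule DERIV_nonneg_imp_nondecreasing[where f = ?q])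
    fix s :: real assume "0 \<le> s" "s \<le> 1"
    then have s: "s \<in> {0..1}" by simp
    have "(?q has_real_derivative C * s + p' 0 - p' s) (at s)"
      using d[OF s] by (auto intro!: derivative_eq_intros)
    then show "\<exists>y. (?q has_real_derivative y) (at s) \<and> 0 \<le> y"
      using b[OF s] by fastforce
  qed simp
  then show ?thesis by simp
qed

lemma taylor_bound_of_lipschitz_deriv:
  fixes p p' :: "real \<Rightarrow> real"
  assumes "\<And>s. s \<in> {0..1} \<Longrightarrow> (p has_real_derivative p' s) (at s)"
    and "\<And>s. s \<in> {0..1} \<Longrightarrow> \<bar>p' s - p' 0\<bar> \<le> C * s"
  shows "\<bar>p 1 - p 0 - p' 0\<bar> \<le> C / 2"
proof -
  have "p 1 - p 0 - p' 0 \<le> C / 2"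
    by (rule taylor_bound_of_lipschitz_deriv_le) (use assms in \<open>auto simp: abs_le_iff\<close>)
  moreover have "- p 1 - - p 0 - - p' 0 \<le> C / 2"
    by (rule taylor_bound_of_lipschitz_deriv_le[where p = "\<lambda>s. - p s" and p' = "\<lambda>s. - p' s"])
      (use assms in \<open>auto simp: abs_le_iff intro: derivative_intros\<close>)
  ultimately show ?thesis by linarith
qed

text \<open>Restriction to the segment from \<open>x\<close> to \<open>z\<close> reduces this to one
  variable. One factor \<open>norm (z - x)\<close> comes from Cauchy-Schwarz, the other from the
  Lipschitz bound on \<open>D\<close>.\<close>

lemma taylor_bound_of_lipschitz_gradient:
  fixes f :: "'a::real_inner \<Rightarrow> real"
  assumes "convex S" and "x \<in> S" and "z \<in> S"
    and d: "\<And>w. w \<in> S \<Longrightarrow> GDERIV f w :> D w"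
    and lip: "K-lipschitz_on S D"
  shows "\<bar>f z - f x - (z - x) \<bullet> D x\<bar> \<le> K / 2 * (norm (z - x))\<^sup>2"
proof -
  let ?h = "z - x"
  have seg: "x + s *\<^sub>R ?h \<in> S" if "s \<in> {0..1}" for s
    using convexD_alt[OF \<open>convex S\<close> \<open>x \<in> S\<close> \<open>z \<in> S\<close>, of s] that by (simp add: algebra_simps)
  \<comment> \<open>The scalars 1 and 0 stay visible so that the one-variable lemma unifies with
    \<open>p 1\<close>, \<open>p 0\<close> and \<open>p' 0\<close>.\<close>
  have "\<bar>f (x + 1 *\<^sub>R ?h) - f (x + 0 *\<^sub>R ?h) - ?h \<bullet> D (x + 0 *\<^sub>R ?h)\<bar> \<le> K * (norm ?h)\<^sup>2 / 2"
  proof (rule taylor_bound_of_lipschitz_deriv)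
    fix s :: real assume s: "s \<in> {0..1}"
    show "((\<lambda>s. f (x + s *\<^sub>R ?h)) has_real_derivative ?h \<bullet> D (x + s *\<^sub>R ?h)) (at s)"
      using seg[OF s] by (intro GDERIV_along_line d)
    have "\<bar>?h \<bullet> D (x + s *\<^sub>R ?h) - ?h \<bullet> D (x + 0 *\<^sub>R ?h)\<bar>
        \<le> norm ?h * norm (D (x + s *\<^sub>R ?h) - D x)"
      by (simp add: inner_diff_right[symmetric] Cauchy_Schwarz_ineq2)
    also have "norm (D (x + s *\<^sub>R ?h) - D x) \<le> K * (s * norm ?h)"
      using lipschitz_onD[OF lip seg[OF s] \<open>x \<in> S\<close>] s by (simp add: dist_norm)
    finally have "\<bar>?h \<bullet> D (x + s *\<^sub>R ?h) - ?h \<bullet> D (x + 0 *\<^sub>R ?h)\<bar>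
        \<le> norm ?h * (K * (s * norm ?h))"
      by (simp add: mult_left_mono)
    then show "\<bar>?h \<bullet> D (x + s *\<^sub>R ?h) - ?h \<bullet> D (x + 0 *\<^sub>R ?h)\<bar> \<le> K * (norm ?h)\<^sup>2 * s"
      by (simp add: power2_eq_square mult_ac)
  qed
  then show ?thesis by simp
qed

section \<open>Subgradients of convex functions\<close>

text \<open>An intersection of half-spaces is convex; this lets convex combinations of active
  gradients be subgradients.\<close>

lemma convex_subdifferential: "convex (subdifferential S f x)"
proof -
  have "subdifferential S f x = (\<Inter>y\<in>S. {v. (y - x) \<bullet> v \<le> f y - f x})"
    by (auto simp: subdifferential_def inner_commute algebra_simps)
  then show ?thesis by (auto intro!: convex_INT convex_halfspace_le)
qed

text \<open>Near \<open>x\<close>, the difference quotients of \<open>h\<close> towards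
  \<open>z\<close> lie below those of \<open>f\<close>, which convexity bounds by
  \<open>f z - f x\<close>. The limit at \<open>x\<close> is the subgradient inequality, even for
  \<open>z\<close> outside \<open>U\<close>.\<close>

lemma gradient_of_minorant_in_subdifferential:
  fixes f h :: "'a::real_inner \<Rightarrow> real"
  assumes cf: "convex_on S f" and "x \<in> S" and U: "open U" "x \<in> U"
    and le: "\<And>z. z \<in> U \<Longrightarrow> h z \<le> f z" and eq: "h x = f x" and d: "GDERIV h x :> D"
  shows "D \<in> subdifferential S f x"
  unfolding subdifferential_def
proof (intro CollectI ballI)
  fix z assume "z \<in> S"
  let ?p = "\<lambda>s::real. h (x + s *\<^sub>R (z - x))"
  have "(?p has_real_derivative (z - x) \<bullet> D) (at 0)"
    using d by (intro GDERIV_along_line) simp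
  then have "((\<lambda>s. (?p s - ?p 0) / (s - 0)) \<longlongrightarrow> (z - x) \<bullet> D) (at 0)"
    by (simp only: has_field_derivative_iff)
  \<comment> \<open>The limit is taken from the right because the convexity inequality is available
    only for \<open>s\<close> between 0 and 1.\<close>
  then have lim: "((\<lambda>s. (?p s - ?p 0) / (s - 0)) \<longlongrightarrow> (z - x) \<bullet> D) (at_right 0)"
    by (rule filterlim_mono[OF _ order_refl]) (simp add: at_le)
  have "((\<lambda>s::real. x + s *\<^sub>R (z - x)) \<longlongrightarrow> x + 0 *\<^sub>R (z - x)) (at_right 0)"
    by (intro tendsto_intros)
  then have "\<forall>\<^sub>F s::real in at_right 0. x + s *\<^sub>R (z - x) \<in> U"
    using U by (auto dest: topological_tendstoD)
  moreover have "\<forall>\<^sub>F s::real in at_right 0. s \<in> {0<..<1}"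
    by (rule eventually_at_right_real) simp
  ultimately have "\<forall>\<^sub>F s in at_right 0. (?p s - ?p 0) / (s - 0) \<le> f z - f x"
  proof eventually_elim
    case (elim s)
    have "?p s \<le> f ((1 - s) *\<^sub>R x + s *\<^sub>R z)"
      using le[OF elim(1)] by (simp add: algebra_simps)
    also have "\<dots> \<le> (1 - s) * f x + s * f z"
      using elim(2) by (intro convex_onD[OF cf] \<open>x \<in> S\<close> \<open>z \<in> S\<close>) auto
    finally show ?case using elim(2) eq by (simp add: field_simps)
  qed
  with lim have "(z - x) \<bullet> D \<le> f z - f x"
    by (rule tendsto_upperbound) simp
  then show "f x + D \<bullet> (z - x) \<le> f z" by (simp add: inner_commute)
qed

section \<open>Norm estimates and matrix inverses\<close>

text \<open>Source of the factor \<open>sqrt (real CARD('m))\<close> in the final bound.\<close>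

lemma norm_le_of_components_le:
  fixes x :: "real^'n"
  assumes "\<And>i. \<bar>x $ i\<bar> \<le> b"
  shows "norm x \<le> sqrt (real CARD('n)) * b"
proof -
  have "0 \<le> b" using assms[of undefined] by linarith
  have "norm x \<le> L2_set (\<lambda>i::'n. b) UNIV"
    unfolding norm_vec_def by (rule L2_set_mono) (use assms in auto)
  also have "\<dots> = sqrt (real CARD('n)) * b"
    using \<open>0 \<le> b\<close> by (simp add: L2_set_def real_sqrt_mult)
  finally show ?thesis .
qed

lemma norm_matrix_vector_mult_le: "norm (A *v x) \<le> spectral_norm A * norm x"
  for A :: "real^'n^'m"
  unfolding spectral_norm_def by (rule onorm) (rule matrix_vector_mul_bounded_linear)

lemma matrix_inv_inverse:
  assumes "invertible A"
  shows "A ** matrix_inv A = mat 1 \<and> matrix_inv A ** A = mat 1"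
  using assms unfolding invertible_def matrix_inv_def by (rule someI_ex)

lemma matrix_vector_mult_matrix_inv:
  fixes A :: "real^'n^'n"
  assumes "invertible A"
  shows "matrix_inv A *v (A *v x) = x"
  using matrix_inv_inverse[OF assms] by (simp add: matrix_vector_mul_assoc)

section \<open>Geometry of poised sample points\<close>

lemma L_matrix_mult_component: "(L_matrix Y *v d) $ i = (Y (Some i) - Y None) \<bullet> d"
  by (simp add: L_matrix_def matrix_vector_mult_def inner_vec_def)

text \<open>The vector holds the coefficients of an affine function with constant term
  \<open>c\<close> and gradient \<open>d\<close>; the sample matrix evaluates that function at the
  sample points.\<close>

lemma sample_matrix_mult_component:
  fixes Y :: "'m::finite option \<Rightarrow> real^'m"
  shows "(sample_matrix Y *v (\<chi> j. case j of None \<Rightarrow> c | Some k \<Rightarrow> d $ k)) $ i = c + Y i \<bullet> d"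
proof -
  have "(sample_matrix Y *v (\<chi> j. case j of None \<Rightarrow> c | Some k \<Rightarrow> d $ k)) $ i =
      (\<Sum>j\<in>UNIV. case j of None \<Rightarrow> c | Some k \<Rightarrow> Y i $ k * d $ k)"
    by (auto simp: sample_matrix_def matrix_vector_mult_def intro!: sum.cong split: option.split)
  also have "\<dots> = c + Y i \<bullet> d"
    by (simp add: UNIV_option_conv sum.reindex inner_vec_def)
  finally show ?thesis .
qed

text \<open>A kernel vector \<open>d\<close> of \<open>L\<close> extends to the kernel vector \<open>(- y\<^sub>0 \<bullet> d, d)\<close> of the sample matrix.\<close>

lemma invertible_L_matrix:
  assumes "poised Y"
  shows "invertible (L_matrix Y)"
proof -
  have "d = 0" if "L_matrix Y *v d = 0" for d
  proof -
    let ?e = "\<chi> j. case j of None \<Rightarrow> - (Y None \<bullet> d) | Some k \<Rightarrow> d $ k"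
    have "(Y (Some k) - Y None) \<bullet> d = 0" for k
      using that L_matrix_mult_component[of Y d k] by simp
    then have "(sample_matrix Y *v ?e) $ i = 0" for i
      unfolding sample_matrix_mult_component by (cases i) (simp_all add: inner_diff_left)
    then have "sample_matrix Y *v ?e = 0" by (simp add: vec_eq_iff)
    then have "?e = 0"
      using matrix_vector_mult_matrix_inv[OF assms[unfolded poised_def], of ?e] by simp
    then have "?e $ Some k = 0" for k by simp
    then show ?thesis by (simp add: vec_eq_iff)
  qed
  then show ?thesis
    by (simp add: invertible_left_inverse matrix_left_invertible_ker)
qed

text \<open>With radius zero all sample points would coincide and \<open>L_matrix Y\<close> would
  vanish, contradicting its invertibility. Positivity justifies dividing by the radius.\<close>

lemma sample_radius_pos:
  assumes "poised Y"
  shows "0 < sample_radius Y"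
proof (rule ccontr)
  assume "\<not> 0 < sample_radius Y"
  moreover have "norm (Y (Some i) - Y None) \<le> sample_radius Y" for i
    unfolding sample_radius_def by (rule Max_ge) auto
  ultimately have "norm (Y (Some i) - Y None) \<le> 0" for i
    by (meson order_trans not_less)
  then have "Y (Some i) = Y None" for i by simp
  \<comment> \<open>Here \<open>1\<close> is the all-ones vector, serving as a nonzero kernel
    vector.\<close>
  then have "L_matrix Y *v 1 = 0"
    by (subst vec_eq_iff) (simp only: L_matrix_mult_component diff_self inner_zero_left zero_index simp_thms)
  then show False
    using matrix_vector_mult_matrix_inv[OF invertible_L_matrix[OF assms], of 1] by simp
qed

section \<open>Linear interpolation models and their gradient error\<close>

text \<open>Hypothesis \<open>D\<close> is the linear system for the gradient; the value at the
  centre then fixes the constant term. Invertibility of \<open>L_matrix Y\<close> gives uniqueness,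
  as the definite description requires.\<close>

lemma interp_model_eq:
  assumes L: "invertible (L_matrix Y)"
    and D: "\<And>i. (Y (Some i) - Y None) \<bullet> D = h (Y (Some i)) - h (Y None)"
  shows "interp_model Y h = (\<lambda>x. x \<bullet> D + (h (Y None) - Y None \<bullet> D))"
  unfolding interp_model_def
proof (rule the_equality)
  show "affine_function (\<lambda>x. x \<bullet> D + (h (Y None) - Y None \<bullet> D)) \<and>
      (\<forall>i. Y i \<bullet> D + (h (Y None) - Y None \<bullet> D) = h (Y i))"
  proof (intro conjI allI)
    show "affine_function (\<lambda>x. x \<bullet> D + (h (Y None) - Y None \<bullet> D))"
      unfolding affine_function_def
      by (blast intro: bounded_linear.linear[OF bounded_linear_inner_left])
    fix i show "Y i \<bullet> D + (h (Y None) - Y None \<bullet> D) = h (Y i)"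
      using D by (cases i) (auto simp: inner_diff_left algebra_simps)
  qed
next
  fix H assume H: "affine_function H \<and> (\<forall>i. H (Y i) = h (Y i))"
  then obtain l c where l: "linear l" and Hl: "H = (\<lambda>x. l x + c)"
    unfolding affine_function_def by blast
  \<comment> \<open>The vector representing the linear part of a competing interpolant.\<close>
  define E where "E = adjoint l 1"
  have lE: "l x = x \<bullet> E" for x
    using adjoint_works[OF l, of x 1] by (simp add: E_def)
  have HY: "Y i \<bullet> E + c = h (Y i)" for i using H by (simp add: Hl lE)
  have "(Y (Some i) - Y None) \<bullet> E = (Y (Some i) - Y None) \<bullet> D" for i
    using HY[of "Some i"] HY[of None] D[of i] by (simp add: inner_diff_left)
  then have "L_matrix Y *v E = L_matrix Y *v D"
    by (simp add: vec_eq_iff L_matrix_mult_component)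
  then have "E = D" by (metis L matrix_vector_mult_matrix_inv)
  with HY[of None] show "H = (\<lambda>x. x \<bullet> D + (h (Y None) - Y None \<bullet> D))"
    by (auto simp: Hl lE)
qed

lemma inner_gradient_interp_model:
  assumes "invertible (L_matrix Y)"
  shows "(Y (Some i) - Y None) \<bullet> gradient (interp_model Y h) x = h (Y (Some i)) - h (Y None)"
proof -
  \<comment> \<open>The solution of the linear system for the model gradient.\<close>
  define D where "D = matrix_inv (L_matrix Y) *v (\<chi> i. h (Y (Some i)) - h (Y None))"
  have "L_matrix Y *v D = (\<chi> i. h (Y (Some i)) - h (Y None))"
    using matrix_inv_inverse[OF assms] by (simp add: D_def matrix_vector_mul_assoc)
  then have D: "(Y (Some i) - Y None) \<bullet> D = h (Y (Some i)) - h (Y None)" for i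
    by (simp add: L_matrix_mult_component[symmetric])
  have "GDERIV (interp_model Y h) x :> D"
    unfolding gderiv_def interp_model_eq[OF assms D] by (auto intro!: derivative_eq_intros)
  with D show ?thesis by (simp add: gradient_eqI)
qed

text \<open>The model is affine, so its gradient is the same at every \<open>z\<close>. The error is
  first bounded at the centre and then carried over to \<open>x\<close>.\<close>

lemma interp_model_gradient_error:
  fixes Y :: "'m::finite option \<Rightarrow> real^'m" and h :: "real^'m \<Rightarrow> real"
  assumes Y: "poised Y" and \<Delta>: "\<Delta> = sample_radius Y"
    and x: "x \<in> cball (Y None) \<Delta>"
    and d: "\<And>w. w \<in> cball (Y None) \<Delta> \<Longrightarrow> GDERIV h w :> gradient h w"
    and lip: "K-lipschitz_on (cball (Y None) \<Delta>) (gradient h)"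
  shows "norm (gradient (interp_model Y h) z - gradient h x) \<le>
    K * (1 + sqrt (real CARD('m)) / 2 * spectral_norm (matrix_inv (Lhat_matrix Y))) * \<Delta>"
proof -
  let ?y0 = "Y None" and ?B = "cball (Y None) \<Delta>" and ?N = "matrix_inv (Lhat_matrix Y)"
  define e where "e = gradient (interp_model Y h) z - gradient h ?y0"
  have pos: "0 < \<Delta>" using sample_radius_pos[OF Y] \<Delta> by simp
  have K: "0 \<le> K" using lip by (rule lipschitz_on_nonneg)
  have y0: "?y0 \<in> ?B" using pos by simp
  have L: "invertible (L_matrix Y)" using invertible_L_matrix[OF Y] .
  then have Lhat: "invertible (Lhat_matrix Y)"
    using pos \<Delta> by (simp add: Lhat_matrix_def scalar_invertible)
  have Yi: "norm (Y (Some i) - ?y0) \<le> \<Delta>" for i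
    unfolding \<Delta> sample_radius_def by (rule Max_ge) auto
  \<comment> \<open>Interpolation turns the model term into a difference of values of
    \<open>h\<close>, so each component is a Taylor remainder on the ball.\<close>
  have "\<bar>(L_matrix Y *v e) $ i\<bar> \<le> K / 2 * \<Delta>\<^sup>2" for i
  proof -
    have "(L_matrix Y *v e) $ i = h (Y (Some i)) - h ?y0 - (Y (Some i) - ?y0) \<bullet> gradient h ?y0"
      unfolding L_matrix_mult_component e_def
      by (simp add: inner_diff_right inner_gradient_interp_model[OF L])
    also have "\<bar>\<dots>\<bar> \<le> K / 2 * (norm (Y (Some i) - ?y0))\<^sup>2"
      using Yi[of i] by (intro taylor_bound_of_lipschitz_gradient[OF _ y0 _ d lip])
        (auto simp: dist_norm norm_minus_commute)
    also have "\<dots> \<le> K / 2 * \<Delta>\<^sup>2"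
      using K Yi[of i] by (intro mult_left_mono power_mono) auto
    finally show ?thesis .
  qed
  then have Le: "norm (L_matrix Y *v e) \<le> sqrt (real CARD('m)) * (K / 2 * \<Delta>\<^sup>2)"
    by (rule norm_le_of_components_le)
  \<comment> \<open>Rescaling by the radius leaves a bound linear in \<open>\<Delta>\<close> and a
    matrix whose inverse has the norm in the claim.\<close>
  have "norm (Lhat_matrix Y *v e) = norm (L_matrix Y *v e) / \<Delta>"
    using pos by (simp add: Lhat_matrix_def \<Delta>[symmetric] scaleR_matrix_vector_assoc[symmetric])
  also have "\<dots> \<le> sqrt (real CARD('m)) * (K / 2 * \<Delta>\<^sup>2) / \<Delta>"
    using Le pos by (intro divide_right_mono) auto
  also have "\<dots> = sqrt (real CARD('m)) / 2 * K * \<Delta>"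
    using pos by (simp add: power2_eq_square)
  finally have *: "norm (Lhat_matrix Y *v e) \<le> sqrt (real CARD('m)) / 2 * K * \<Delta>" .
  have "norm e = norm (?N *v (Lhat_matrix Y *v e))"
    by (simp add: matrix_vector_mult_matrix_inv[OF Lhat])
  also have "\<dots> \<le> spectral_norm ?N * norm (Lhat_matrix Y *v e)"
    by (rule norm_matrix_vector_mult_le)
  also have "\<dots> \<le> spectral_norm ?N * (sqrt (real CARD('m)) / 2 * K * \<Delta>)"
    using * by (rule mult_left_mono)
      (simp add: spectral_norm_def onorm_pos_le matrix_vector_mul_bounded_linear)
  finally have e: "norm e \<le> spectral_norm ?N * (sqrt (real CARD('m)) / 2 * K * \<Delta>)" .
  \<comment> \<open>Moving from the centre to \<open>x\<close> contributes the summand 1 in the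
    constant.\<close>
  have "norm (gradient h ?y0 - gradient h x) \<le> K * dist ?y0 x"
    using lipschitz_onD[OF lip y0 x] by (simp add: dist_norm)
  also have "\<dots> \<le> K * \<Delta>" using K x by (intro mult_left_mono) auto
  finally have "norm (e + (gradient h ?y0 - gradient h x)) \<le>
      spectral_norm ?N * (sqrt (real CARD('m)) / 2 * K * \<Delta>) + K * \<Delta>"
    using e by (intro norm_triangle_mono)
  then show ?thesis by (simp add: e_def algebra_simps)
qed

section \<open>Convex combinations of model gradients as approximate subgradients\<close>

theorem theorem3p3:
  fixes \<Omega> \<Omega>' X :: "(real^'m) set"
    and f g :: "real^'m \<Rightarrow> real"
    and Tf :: "'s topology" and F :: "'s \<Rightarrow> real^'m \<Rightarrow> real"
    and Tg :: "'t topology" and G :: "'t \<Rightarrow> real^'m \<Rightarrow> real"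
    and Kf \<Delta> :: real
    and Y :: "'m option \<Rightarrow> real^'m" and y V :: "real^'m"
    and r :: nat and ts :: "nat \<Rightarrow> 's" and lam :: "nat \<Rightarrow> real"
  assumes "\<Omega> \<noteq> {}" and "open \<Omega>" and "convex \<Omega>"
    and "continuous_on \<Omega> f" and "convex_on \<Omega> f"
    and "continuous_on \<Omega> g" and "convex_on \<Omega> g"
    and "X \<subseteq> \<Omega>" and "X \<noteq> {}" and "compact X" and "convex X" and "\<nexists>a. X = {a}"
    and "optimal_set X f g \<noteq> {}"
    and "open \<Omega>'" and "X \<subseteq> \<Omega>'" and "\<Omega>' \<subseteq> \<Omega>"
    and "lower_C2_rep Tf F f \<Omega>'" and "lower_C2_rep Tg G g \<Omega>'"
    and "Kf \<ge> 0" and "\<forall>t \<in> topspace Tf. Kf-lipschitz_on \<Omega>' (gradient (F t))"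
    and "poised_wrt \<Omega> Y" and "Y None \<in> X"
    and "\<Delta> = sample_radius Y" and "cball (Y None) \<Delta> \<subseteq> X"
    and "y \<in> cball (Y None) \<Delta>"
    and "\<forall>i \<in> {1..r}. ts i \<in> active_set Tf F y"
    and "\<forall>i \<in> {1..r}. lam i \<in> {0..1}" and "(\<Sum>i=1..r. lam i) = 1"
    and "V = (\<Sum>i=1..r. lam i *\<^sub>R gradient (interp_model Y (F (ts i))) y)"
  shows "\<exists>v \<in> subdifferential \<Omega> f y.
    norm (V - v) \<le>
      Kf * (1 + sqrt (real CARD('m)) / 2 * spectral_norm (matrix_inv (Lhat_matrix Y))) * \<Delta>"
proof -
  have B: "cball (Y None) \<Delta> \<subseteq> \<Omega>'" using assms by blast
  have grad: "GDERIV (F t) w :> gradient (F t) w" if "t \<in> topspace Tf" "w \<in> \<Omega>'" for t w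
    using that \<open>lower_C2_rep Tf F f \<Omega>'\<close>
    by (intro differentiable_imp_GDERIV_gradient) (auto simp: lower_C2_rep_def C2_on_def)
  have f_ge: "F t w \<le> f w" if "t \<in> topspace Tf" "w \<in> \<Omega>'" for t w
    using that \<open>lower_C2_rep Tf F f \<Omega>'\<close> unfolding lower_C2_rep_def active_set_def by fastforce
  have y: "y \<in> \<Omega>'" "y \<in> \<Omega>" using B assms by auto
  have act: "ts i \<in> topspace Tf" "F (ts i) y = f y" if i: "i \<in> {1..r}" for i
  proof -
    have ti: "ts i \<in> active_set Tf F y" using assms i by blast
    then show "ts i \<in> topspace Tf" by (simp add: active_set_def)
    \<comment> \<open>The representation supplies only one active index with value
      \<open>f y\<close>; maximality makes all active indices share that value.\<close>
    obtain t where "t \<in> active_set Tf F y" "f y = F t y"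
      using \<open>lower_C2_rep Tf F f \<Omega>'\<close> y unfolding lower_C2_rep_def by blast
    with ti show "F (ts i) y = f y" by (auto simp: active_set_def intro: antisym)
  qed
  let ?b = "Kf * (1 + sqrt (real CARD('m)) / 2 * spectral_norm (matrix_inv (Lhat_matrix Y))) * \<Delta>"
  define v where "v = (\<Sum>i=1..r. lam i *\<^sub>R gradient (F (ts i)) y)"
  have lam: "0 \<le> lam i" if "i \<in> {1..r}" for i using assms that by auto
  have "v \<in> subdifferential \<Omega> f y"
    unfolding v_def
  proof (rule convex_sum)
    fix i assume i: "i \<in> {1..r}"
    show "gradient (F (ts i)) y \<in> subdifferential \<Omega> f y"
      by (rule gradient_of_minorant_in_subdifferential[where h = "F (ts i)" and U = \<Omega>'])
        (use assms y act[OF i] in \<open>auto intro: f_ge grad\<close>)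
  qed (use assms lam in \<open>auto intro: convex_subdifferential\<close>)
  moreover have "norm (V - v) \<le> ?b"
  proof -
    have "V - v = (\<Sum>i=1..r. lam i *\<^sub>R
        (gradient (interp_model Y (F (ts i))) y - gradient (F (ts i)) y))"
      unfolding v_def \<open>V = _\<close> by (simp add: sum_subtractf scaleR_diff_right)
    also have "norm \<dots> \<le> (\<Sum>i=1..r. lam i * ?b)"
    proof (rule sum_norm_le)
      fix i assume i: "i \<in> {1..r}"
      have "norm (gradient (interp_model Y (F (ts i))) y - gradient (F (ts i)) y) \<le> ?b"
      proof (rule interp_model_gradient_error)
        show "poised Y" using \<open>poised_wrt \<Omega> Y\<close> by (simp add: poised_wrt_def)
        show "Kf-lipschitz_on (cball (Y None) \<Delta>) (gradient (F (ts i)))"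
          using assms act[OF i] B by (blast intro: lipschitz_on_subset)
      qed (use assms act[OF i] B in \<open>auto intro!: grad\<close>)
      then show "norm (lam i *\<^sub>R (gradient (interp_model Y (F (ts i))) y - gradient (F (ts i)) y))
          \<le> lam i * ?b"
        using lam[OF i] by (simp add: mult_left_mono)
    qed
    also have "\<dots> = ?b" using \<open>sum lam {1..r} = 1\<close> by (simp add: sum_distrib_right[symmetric])
    finally show ?thesis .
  qed
  ultimately show ?thesis by blast
qed

end
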